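(* Let $\mathcal{P}$ be a finite regular polyhedral poset, with simplicial transform $s(\mathcal{P})$. Then for every $i\ge 0$, $$f_i(s(\mathcal{P}))=f_i(\mathcal{P})+\sum_{k=i+1}^{\|\mathcal{P}\|}f_k(\mathcal{P})\,\nu_{i,k}(\mathcal{P}).$$
   Context: For a pointed poset $\mathcal{P}$ with least object $*$, a vertex is an object $v\ne *$ such that $y<v$ implies $y=*$. $V_\mathcal{P}$ is the set of vertices, and $V(x)=\{v\in V_\mathcal{P}\mid v\le x\}$. $[x\vee y]$ is the set of minimal upper bounds of $\{x,y\}$, and $\mathcal{P}_{\le x}=\{y\mid y\le x\}$. A finite pointed poset is polyhedral if every $\mathcal{P}_{\le x}$ is a lower semilattice (any two objects have a meet). It is regular if $\mathcal{P}_{\le x}\cong\mathcal{P}_{\le y}$ whenever $|V(x)|=|V(y)|$. Simplicial transform: on the set of pairs $(x,S)$ with $x\in\mathcal{P}$ and $S\subseteq V(x)$, take the equivalence relation that is the transitive closure of the relation $(x,S)\sim(y,T)$ if $S=T$ and $[x\vee y]\ne\emptyset$. $s(\mathcal{P})$ is the set of equivalence classes $[x,S]$, partially ordered by $[x,S]\le[y,T]$ if, for some choice of representatives, $S\subseteq T$ and $[x\vee y]\ne\emptyset$. Its vertices are identified with $V_\mathcal{P}$, and $V([x,S])=S$. For a finite pointed poset $\mathcal{Q}$, $\|\mathcal{Q}\|=\max\{|V_\mathcal{Q}(x)| : x\in\mathcal{Q}\}-1$, and $f_i(\mathcal{Q})$ is the number of $x\in\mathcal{Q}$ with $|V_\mathcal{Q}(x)|=i+1$.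 Numbers $\nu_{i,k}(\mathcal{P})$: $\nu_{0,k}(\mathcal{P})=0$. For $1\le i<k$, fix $x\in\mathcal{P}$ with $|V(x)|=k+1$ (by regularity the choice does not matter); $\nu_{i,k}(\mathcal{P})$ is the number of objects $[x,S]$ of $s(\mathcal{P}_{\le x})$ (every object of $s(\mathcal{P}_{\le x})$ has this form with $S\subseteq V(x)$) such that (i) $|S|=i+1$, and (ii) there is no $y\lneq x$ with $S\subseteq V(y)$. If no $x$ with $|V(x)|=k+1$ exists, then $f_k(\mathcal{P})=0$ and the corresponding term is $0$. *)

theory Defs
  imports "HOL-Algebra.Lattice"
begin

text \<open>
  Posets are \<^typ>\<open>'a gorder\<close> records satisfying \<^locale>\<open>partial_order\<close>.  The distinguished least
  object \<open>*\<close> of a pointed poset is \<open>\<bottom>\<^bsub>P\<^esub>\<close>.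
\<close>

locale pointed_poset = partial_order P + weak_partial_order_bottom P
  for P :: "'a gorder" (structure)

definition vertices :: "'a gorder \<Rightarrow> 'a set" where
  "vertices P = {v \<in> carrier P. v \<noteq> \<bottom>\<^bsub>P\<^esub> \<and> (\<forall>y\<in>carrier P. y \<sqsubset>\<^bsub>P\<^esub> v \<longrightarrow> y = \<bottom>\<^bsub>P\<^esub>)}"

definition vertices_of :: "'a gorder \<Rightarrow> 'a \<Rightarrow> 'a set" where
  "vertices_of P x = {v \<in> vertices P. v \<sqsubseteq>\<^bsub>P\<^esub> x}"

definition min_upper_bounds :: "'a gorder \<Rightarrow> 'a \<Rightarrow> 'a \<Rightarrow> 'a set" where
  "min_upper_bounds P x y =
     {u \<in> Upper P {x, y}. \<forall>w\<in>Upper P {x, y}. w \<sqsubseteq>\<^bsub>P\<^esub> u \<longrightarrow> w = u}"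

definition down_poset :: "'a gorder \<Rightarrow> 'a \<Rightarrow> 'a gorder" where
  "down_poset P x = P\<lparr>carrier := {y \<in> carrier P. y \<sqsubseteq>\<^bsub>P\<^esub> x}\<rparr>"

definition poset_isomorphic :: "'a gorder \<Rightarrow> 'b gorder \<Rightarrow> bool" where
  "poset_isomorphic P Q \<longleftrightarrow> (\<exists>f. order_emb P Q f \<and> bij_betw f (carrier P) (carrier Q))"

definition polyhedral :: "'a gorder \<Rightarrow> bool" where
  "polyhedral P \<longleftrightarrow> (\<forall>x\<in>carrier P. lower_semilattice (down_poset P x))"

definition regular_poset :: "'a gorder \<Rightarrow> bool" where
  "regular_poset P \<longleftrightarrow>
     (\<forall>x\<in>carrier P. \<forall>y\<in>carrier P. card (vertices_of P x) = card (vertices_of P y) \<longrightarrow>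
        poset_isomorphic (down_poset P x) (down_poset P y))"

definition marked_objects :: "'a gorder \<Rightarrow> ('a \<times> 'a set) set" where
  "marked_objects P = {(x, S). x \<in> carrier P \<and> S \<subseteq> vertices_of P x}"

definition marked_adj :: "'a gorder \<Rightarrow> (('a \<times> 'a set) \<times> ('a \<times> 'a set)) set" where
  "marked_adj P = {((x, S), (y, T)). (x, S) \<in> marked_objects P \<and> (y, T) \<in> marked_objects P \<and>
     S = T \<and> min_upper_bounds P x y \<noteq> {}}"

definition marked_class :: "'a gorder \<Rightarrow> 'a \<Rightarrow> 'a set \<Rightarrow> ('a \<times> 'a set) set" where
  "marked_class P x S = (marked_adj P)\<^sup>+ `` {(x, S)}"

definition simplicial_transform :: "'a gorder \<Rightarrow> ('a \<times> 'a set) set gorder" where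
  "simplicial_transform P =
     \<lparr>carrier = marked_objects P // (marked_adj P)\<^sup>+,
      eq = (=),
      le = (\<lambda>c d. \<exists>(x, S)\<in>c. \<exists>(y, T)\<in>d. S \<subseteq> T \<and> min_upper_bounds P x y \<noteq> {})\<rparr>"

text \<open>Integer-valued, since the one-object poset has dimension \<open>-1\<close>.\<close>

definition poset_dim :: "'a gorder \<Rightarrow> int" where
  "poset_dim Q = int (Max ((\<lambda>x. card (vertices_of Q x)) ` carrier Q)) - 1"

definition face_number :: "'a gorder \<Rightarrow> nat \<Rightarrow> nat" where
  "face_number Q i = card {x \<in> carrier Q. card (vertices_of Q x) = i + 1}"

definition nu_at :: "'a gorder \<Rightarrow> nat \<Rightarrow> 'a \<Rightarrow> nat" where
  "nu_at P i x = card {c \<in> carrier (simplicial_transform (down_poset P x)).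
     \<exists>S\<subseteq>vertices_of P x. c = marked_class (down_poset P x) x S \<and> card S = i + 1 \<and>
       \<not> (\<exists>y\<in>carrier P. y \<sqsubset>\<^bsub>P\<^esub> x \<and> S \<subseteq> vertices_of P y)}"

text \<open>
  Only meaningful for \<open>i = 0\<close> or \<open>i < k\<close>, and only if some \<open>x\<close> has \<open>k + 1\<close> vertices; otherwise
  \<^term>\<open>face_number P k = 0\<close>.  For regular \<open>P\<close> the choice of \<open>x\<close> is irrelevant: see \<open>nu_eq\<close> below.
\<close>

definition nu :: "'a gorder \<Rightarrow> nat \<Rightarrow> nat \<Rightarrow> nat" where
  "nu P i k =
     (if i = 0 then 0 else nu_at P i (SOME x. x \<in> carrier P \<and> card (vertices_of P x) = k + 1))"

subsection \<open>Independence of \<open>nu\<close> from the chosen object\<close>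

context pointed_poset
begin

lemma lless_iff: "x \<sqsubset> y \<longleftrightarrow> x \<sqsubseteq> y \<and> x \<noteq> y"
  by (simp add: lless_def eq_is_equal)

lemma bottom_down_poset:
  assumes x: "x \<in> carrier P"
  shows "\<bottom>\<^bsub>down_poset P x\<^esub> = \<bottom>"
proof -
  have "least (down_poset P x) \<bottom> (carrier (down_poset P x))"
    using x by (auto simp: least_def down_poset_def)
  then have "least (down_poset P x) \<bottom>\<^bsub>down_poset P x\<^esub> (carrier (down_poset P x))"
    unfolding bottom_def[of "down_poset P x"] by (rule someI)
  then have b: "\<bottom>\<^bsub>down_poset P x\<^esub> \<in> carrier P" "\<bottom>\<^bsub>down_poset P x\<^esub> \<sqsubseteq> \<bottom>"
    using x by (auto simp: least_def down_poset_def)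
  then show ?thesis
    by (intro le_antisym) auto
qed

lemma vertices_of_down_poset:
  assumes x: "x \<in> carrier P" and z: "z \<in> carrier P" "z \<sqsubseteq> x"
  shows "vertices_of (down_poset P x) z = vertices_of P z"
proof -
  have l: "u \<sqsubset>\<^bsub>down_poset P x\<^esub> v \<longleftrightarrow> u \<sqsubset> v" for u v
    by (simp add: lless_def down_poset_def)
  have "v \<sqsubseteq> x" if "v \<in> carrier P" "v \<sqsubseteq> z" for v
    using that x z le_trans by blast
  moreover have "u \<sqsubseteq> x" if "u \<in> carrier P" "u \<sqsubset> v" "v \<in> carrier P" "v \<sqsubseteq> x" for u v
    using that x le_trans lless_iff by blast
  ultimately show ?thesis
    unfolding vertices_of_def vertices_def bottom_down_poset[OF x] l
    by (auto simp: down_poset_def)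
qed

definition uncovered :: "nat \<Rightarrow> 'a \<Rightarrow> 'a set set" where
  "uncovered i x = {S. S \<subseteq> vertices_of P x \<and> card S = i + 1 \<and>
     \<not> (\<exists>y\<in>carrier P. y \<sqsubset> x \<and> S \<subseteq> vertices_of P y)}"

lemma marked_adj_trancl_snd:
  assumes "(p, q) \<in> (marked_adj Q)\<^sup>+" shows "snd p = snd q"
proof -
  have adj: "snd p = snd q" if "(p, q) \<in> marked_adj Q" for p q
    using that unfolding marked_adj_def by (cases p; cases q) simp
  show ?thesis
    using assms by (induction rule: trancl_induct) (simp_all add: adj)
qed

lemma nu_at_eq_card_uncovered:
  assumes x: "x \<in> carrier P"
  shows "nu_at P i x = card (uncovered i x)"
proof -
  let ?D = "down_poset P x"
  have cls: "(x, S) \<in> marked_class ?D x S" "marked_class ?D x S \<in> carrier (simplicial_transform ?D)"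
    if S: "S \<subseteq> vertices_of P x" for S
  proof -
    have m: "(x, S) \<in> marked_objects ?D"
      using S x vertices_of_down_poset[OF x x] by (auto simp: marked_objects_def down_poset_def)
    have "x \<in> min_upper_bounds ?D x x"
      using x by (auto simp: min_upper_bounds_def Upper_def down_poset_def)
    then have "((x, S), (x, S)) \<in> marked_adj ?D"
      using m by (auto simp add: marked_adj_def)
    then show "(x, S) \<in> marked_class ?D x S"
      unfolding marked_class_def by (intro ImageI[of "(x, S)"] r_into_trancl) simp_all
    show "marked_class ?D x S \<in> carrier (simplicial_transform ?D)"
      using quotientI[OF m] by (simp add: marked_class_def simplicial_transform_def)
  qed
  have "inj_on (marked_class ?D x) (uncovered i x)"
  proof (rule inj_onI)
    fix S T assume "S \<in> uncovered i x" and eq: "marked_class ?D x S = marked_class ?D x T"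
    then have "(x, S) \<in> marked_class ?D x T"
      using cls(1)[of S] unfolding uncovered_def by blast
    then show "S = T"
      using marked_adj_trancl_snd[of "(x, T)" "(x, S)" ?D] unfolding marked_class_def by simp
  qed
  moreover have "{c \<in> carrier (simplicial_transform ?D).
     \<exists>S\<subseteq>vertices_of P x. c = marked_class ?D x S \<and> card S = i + 1 \<and>
       \<not> (\<exists>y\<in>carrier P. y \<sqsubset> x \<and> S \<subseteq> vertices_of P y)} = marked_class ?D x ` uncovered i x"
    using cls(2) unfolding uncovered_def by blast
  ultimately show ?thesis
    by (simp add: nu_at_def card_image)
qed

lemma card_uncovered_le:
  assumes fin: "finite (carrier P)" and x: "x \<in> carrier P" and y: "y \<in> carrier P"
    and iso: "poset_isomorphic (down_poset P x) (down_poset P y)"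
  shows "card (uncovered i x) \<le> card (uncovered i y)"
proof -
  define X where "X = {z \<in> carrier P. z \<sqsubseteq> x}"
  define Y where "Y = {z \<in> carrier P. z \<sqsubseteq> y}"
  obtain f where f: "bij_betw f X Y" and le: "\<And>u v. u \<in> X \<Longrightarrow> v \<in> X \<Longrightarrow> f u \<sqsubseteq> f v \<longleftrightarrow> u \<sqsubseteq> v"
  proof -
    obtain f where "order_emb (down_poset P x) (down_poset P y) f"
      "bij_betw f (carrier (down_poset P x)) (carrier (down_poset P y))"
      using iso unfolding poset_isomorphic_def by blast
    then show thesis
      by (intro that[of f]) (simp_all add: order_emb_def X_def Y_def down_poset_def)
  qed
  have inj: "inj_on f X" and fX: "f ` X = Y"
    using f by (auto simp: bij_betw_def)
  have X: "x \<in> X" "\<bottom> \<in> X" and Y: "y \<in> Y" "\<bottom> \<in> Y"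
    using x y by (auto simp: X_def Y_def)
  have fx: "f x = y"
  proof (rule le_antisym)
    show "f x \<in> carrier P" "f x \<sqsubseteq> y" using fX X by (auto simp: Y_def)
    obtain z where "z \<in> X" "f z = y" using fX Y by auto
    then show "y \<sqsubseteq> f x" using le[of z x] X by (auto simp: X_def)
  qed (rule y)
  have fb: "f \<bottom> = \<bottom>"
  proof (rule le_antisym)
    show "f \<bottom> \<in> carrier P" "\<bottom> \<sqsubseteq> f \<bottom>" using fX X by (auto simp: Y_def)
    obtain z where "z \<in> X" "f z = \<bottom>" using fX Y by auto
    then show "f \<bottom> \<sqsubseteq> \<bottom>" using le[of \<bottom> z] X by (auto simp: X_def)
  qed simp
  have feq: "f u = f v \<longleftrightarrow> u = v" if "u \<in> X" "v \<in> X" for u v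
    using inj that by (auto dest: inj_onD)
  have dX: "u \<in> X" if "u \<in> carrier P" "u \<sqsubseteq> v" "v \<in> X" for u v
    using that x le_trans unfolding X_def by blast
  have dY: "u \<in> Y" if "u \<in> carrier P" "u \<sqsubseteq> v" "v \<in> Y" for u v
    using that y le_trans unfolding Y_def by blast
  have vert: "f v \<in> vertices P \<longleftrightarrow> v \<in> vertices P" if v: "v \<in> X" for v
  proof -
    have carr: "v \<in> carrier P" "f v \<in> carrier P" "f v \<in> Y"
      using v fX by (auto simp: X_def Y_def)
    have "(\<forall>u\<in>carrier P. u \<sqsubset> f v \<longrightarrow> u = \<bottom>) \<longleftrightarrow> (\<forall>u\<in>Y. u \<sqsubset> f v \<longrightarrow> u = \<bottom>)"
      using dY carr(3) by (auto simp: lless_iff Y_def)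
    also have "\<dots> \<longleftrightarrow> (\<forall>u\<in>X. f u \<sqsubset> f v \<longrightarrow> f u = \<bottom>)"
      unfolding fX[symmetric] by simp
    also have "\<dots> \<longleftrightarrow> (\<forall>u\<in>X. u \<sqsubset> v \<longrightarrow> u = \<bottom>)"
      using le[OF _ v] feq[OF _ v] feq[OF _ X(2)] fb by (simp add: lless_iff)
    also have "\<dots> \<longleftrightarrow> (\<forall>u\<in>carrier P. u \<sqsubset> v \<longrightarrow> u = \<bottom>)"
      using dX v by (auto simp: lless_iff X_def)
    finally show ?thesis
      using carr feq[OF v X(2)] fb by (auto simp: vertices_def)
  qed
  have vX: "vertices_of P z \<subseteq> X" if "z \<in> X" for z
    using dX that by (auto simp: vertices_of_def vertices_def)
  have vimg: "vertices_of P (f z) = f ` vertices_of P z" if z: "z \<in> X" for z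
  proof (intro subset_antisym subsetI)
    fix w assume w: "w \<in> vertices_of P (f z)"
    then have "w \<in> Y"
      using dY[of w "f z"] z fX by (auto simp: vertices_of_def vertices_def)
    then obtain v where "v \<in> X" "w = f v" using fX by auto
    then show "w \<in> f ` vertices_of P z"
      using w vert le z by (auto simp: vertices_of_def)
  next
    fix w assume "w \<in> f ` vertices_of P z"
    then show "w \<in> vertices_of P (f z)"
      using vX[OF z] vert le z by (auto simp: vertices_of_def subset_iff)
  qed
  have "inj_on ((`) f) (uncovered i x)"
    using inj vX[OF X(1)] by (intro inj_onI) (auto simp: uncovered_def inj_on_image_eq_iff)
  moreover have "(`) f ` uncovered i x \<subseteq> uncovered i y"
  proof safe
    fix S assume S: "S \<in> uncovered i x"
    then have Sv: "S \<subseteq> vertices_of P x" and SX: "S \<subseteq> X"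
      using vX[OF X(1)] by (auto simp: uncovered_def)
    have "f ` S \<subseteq> vertices_of P y"
      using Sv vimg[OF X(1)] fx by auto
    moreover have "card (f ` S) = i + 1"
      using S card_image[OF inj_on_subset[OF inj SX]] by (simp add: uncovered_def)
    moreover have False if z: "z \<in> carrier P" "z \<sqsubset> y" "f ` S \<subseteq> vertices_of P z" for z
    proof -
      have "z \<in> Y" using z by (auto simp: lless_iff Y_def)
      then obtain w where w: "w \<in> X" "z = f w" using fX by auto
      have "f ` S \<subseteq> f ` vertices_of P w" using z w vimg by simp
      then have "S \<subseteq> vertices_of P w"
        using SX vX[OF w(1)] feq by blast
      moreover have "w \<sqsubset> x" "w \<in> carrier P"
        using z(2) w fx by (auto simp: lless_iff X_def)
      ultimately show False using S by (auto simp: uncovered_def)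
    qed
    ultimately show "f ` S \<in> uncovered i y" by (auto simp: uncovered_def)
  qed
  moreover have "finite (uncovered i y)"
  proof (rule finite_subset)
    show "uncovered i y \<subseteq> Pow (carrier P)"
      by (auto simp: uncovered_def vertices_of_def vertices_def)
  qed (simp add: fin)
  ultimately show ?thesis
    by (metis card_image card_mono)
qed

theorem nu_eq:
  assumes "finite (carrier P)" and reg: "regular_poset P"
    and x: "x \<in> carrier P" "card (vertices_of P x) = k + 1" and i: "i > 0"
  shows "nu P i k = nu_at P i x"
proof -
  let ?y = "SOME x. x \<in> carrier P \<and> card (vertices_of P x) = k + 1"
  have y: "?y \<in> carrier P \<and> card (vertices_of P ?y) = k + 1"
    by (rule someI) (use x in blast)
  have "poset_isomorphic (down_poset P x) (down_poset P ?y)"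
    "poset_isomorphic (down_poset P ?y) (down_poset P x)"
    using reg x y unfolding regular_poset_def by metis+
  then have "card (uncovered i x) = card (uncovered i ?y)"
    using assms y by (intro antisym card_uncovered_le) auto
  then show ?thesis
    using i x y by (simp add: nu_def nu_at_eq_card_uncovered)
qed

end

end

theory Submission
  imports Defs
begin

text \<open>
  An object of \<open>s(P)\<close> is a class of pairs \<open>(x, S)\<close>, and all members of a class share the marking
  \<open>S\<close>.  The proof counts classes by exhibiting in each one a canonical pair.

  Fix \<open>(x, S)\<close> and consider the objects \<open>y \<sqsubseteq> x\<close> whose vertex set contains \<open>S\<close>.  In a polyhedral
  poset these are closed under the meets taken below \<open>x\<close>, because a vertex below two objects is
  below their meet; by finiteness there is a least one, \<open>m\<close> (\<open>ex_least_spanning\<close>).  Passing from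
  \<open>x\<close> to a larger object \<open>u\<close> does not change \<open>m\<close>, since \<open>x\<close> itself competes below \<open>u\<close>; hence
  \<open>m\<close> depends only on the class (\<open>least_spanning_adj\<close>).  The pair \<open>(m, S)\<close> lies in the class of
  \<open>(x, S)\<close>, and \<open>S\<close> is contained in the vertex set of no object strictly below \<open>m\<close>.  So the classes
  with \<open>i + 1\<close> vertices correspond to the pairs \<open>(m, S)\<close> with \<open>S \<in> uncovered i m\<close>
  (\<open>face_number_transform\<close>).

  It remains to sort these pairs by the number \<open>k + 1\<close> of vertices of \<open>m\<close>.  If \<open>k = i\<close>, the only
  candidate for \<open>S\<close> is the full vertex set of \<open>m\<close>, and regularity makes it uncovered: an object
  strictly below \<open>m\<close> with the same vertices would have a down-set isomorphic to a proper subset of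
  the finite down-set of \<open>m\<close>.  This contributes \<open>f\<^sub>i(P)\<close>.  Each \<open>m\<close> with \<open>k > i\<close> contributes
  \<open>\<nu>\<^sub>i\<^sub>,\<^sub>k\<close>; for \<open>i = 0\<close> this is zero, as a single vertex of \<open>m\<close> is covered by itself.

  All of this speaks of the cardinality of \<open>S\<close>, while \<open>f\<^sub>i(s(P))\<close> counts vertices of \<open>s(P)\<close> as a
  poset.  Two classes are comparable exactly if they have representatives \<open>(u, S)\<close> and \<open>(u, T)\<close> on
  one object \<open>u\<close> with \<open>S \<subseteq> T\<close> (\<open>transform_le_iff\<close>).  Thus the vertices of \<open>s(P)\<close> are the classes
  with singleton marking, one for each vertex of \<open>P\<close>, and those below the class of \<open>(x, S)\<close> are
  given by the elements of \<open>S\<close> (\<open>card_vertices_of_transform\<close>).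
\<close>

locale finite_pointed_poset = pointed_poset +
  assumes fin: "finite (carrier P)"
begin

section \<open>Vertices and minimal elements in a finite poset\<close>

lemma vertices_in_carrier: "v \<in> vertices P \<Longrightarrow> v \<in> carrier P"
  by (simp add: vertices_def)

lemma vertices_of_subset_carrier: "vertices_of P x \<subseteq> carrier P"
  by (simp add: vertices_of_def vertices_in_carrier subset_iff)

lemma finite_vertices_of: "finite (vertices_of P x)"
  by (rule finite_subset[OF vertices_of_subset_carrier fin])

lemma vertices_of_mono:
  assumes "x \<in> carrier P" "y \<in> carrier P" "x \<sqsubseteq> y"
  shows "vertices_of P x \<subseteq> vertices_of P y"
proof
  fix v assume "v \<in> vertices_of P x"
  then have "v \<in> vertices P" "v \<sqsubseteq> x" by (simp_all add: vertices_of_def)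
  then show "v \<in> vertices_of P y"
    using le_trans[of v x y] assms by (simp add: vertices_of_def vertices_in_carrier)
qed

lemma vertices_of_vertex:
  assumes "v \<in> vertices P"
  shows "vertices_of P v = {v}"
proof (intro subset_antisym subsetI)
  fix u assume "u \<in> vertices_of P v"
  then have "u \<in> carrier P" "u \<noteq> \<bottom>" "u \<sqsubseteq> v" by (simp_all add: vertices_of_def vertices_def)
  then show "u \<in> {v}" using assms by (auto simp: vertices_def lless_iff)
next
  fix u assume "u \<in> {v}"
  then show "u \<in> vertices_of P v"
    using assms by (simp add: vertices_of_def vertices_in_carrier)
qed

text \<open>
  An element of \<open>A\<close> whose down-set has least cardinality is minimal.
\<close>

lemma ex_minimal:
  assumes A: "A \<subseteq> carrier P" "A \<noteq> {}"
  shows "\<exists>m\<in>A. \<forall>w\<in>A. w \<sqsubseteq> m \<longrightarrow> w = m"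
proof -
  let ?D = "\<lambda>y. {z \<in> carrier P. z \<sqsubseteq> y}"
  obtain a where "a \<in> A" using A by blast
  from ex_has_least_nat[of "\<lambda>y. y \<in> A", OF this, of "\<lambda>y. card (?D y)"]
  obtain m where m: "m \<in> A" "\<And>y. y \<in> A \<Longrightarrow> card (?D m) \<le> card (?D y)" by blast
  have "w = m" if w: "w \<in> A" "w \<sqsubseteq> m" for w
  proof -
    have c: "w \<in> carrier P" "m \<in> carrier P" using w m A by auto
    have "?D w \<subseteq> ?D m" using c w by (blast intro: le_trans)
    then have "?D w = ?D m"
      using fin m(2)[OF w(1)] by (intro card_seteq) auto
    then have "m \<sqsubseteq> w" using c by auto
    then show ?thesis using c w le_antisym by blast
  qed
  then show ?thesis using m by blast
qed

text \<open>
  By finiteness a bound can always be shrunk to a minimal one, so adjacency of marked objects only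
  asks for a common upper bound.
\<close>

lemma min_upper_bounds_nonempty_iff:
  assumes "x \<in> carrier P" "y \<in> carrier P"
  shows "min_upper_bounds P x y \<noteq> {} \<longleftrightarrow> (\<exists>u\<in>carrier P. x \<sqsubseteq> u \<and> y \<sqsubseteq> u)"
proof -
  have U: "Upper P {x, y} = {u \<in> carrier P. x \<sqsubseteq> u \<and> y \<sqsubseteq> u}"
    using assms by (auto simp: Upper_def)
  show ?thesis
    using ex_minimal[of "Upper P {x, y}"] unfolding min_upper_bounds_def U by blast
qed

section \<open>The order of the simplicial transform\<close>

lemma marked_adj_iff:
  "((x, S), (y, T)) \<in> marked_adj P \<longleftrightarrow>
     x \<in> carrier P \<and> y \<in> carrier P \<and> S = T \<and> S \<subseteq> vertices_of P x \<and> S \<subseteq> vertices_of P y \<and>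
     (\<exists>u\<in>carrier P. x \<sqsubseteq> u \<and> y \<sqsubseteq> u)"
  using min_upper_bounds_nonempty_iff[of x y]
  by (auto simp: marked_adj_def marked_objects_def)

lemma equiv_marked: "equiv (marked_objects P) ((marked_adj P)\<^sup>+)"
proof (rule equivI)
  have sub: "marked_adj P \<subseteq> marked_objects P \<times> marked_objects P"
    by (auto simp: marked_adj_def)
  show "(marked_adj P)\<^sup>+ \<subseteq> marked_objects P \<times> marked_objects P"
    using trancl_subset_Sigma[OF sub] .
  have "(p, p) \<in> marked_adj P" if "p \<in> marked_objects P" for p
    using that by (cases p) (auto simp: marked_adj_iff marked_objects_def)
  then show "refl_on (marked_objects P) ((marked_adj P)\<^sup>+)"
    by (auto simp: refl_on_def)
  have "sym (marked_adj P)"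
    by (rule symI) (auto simp: marked_adj_iff)
  then show "sym ((marked_adj P)\<^sup>+)" by (rule sym_trancl)
qed (rule trans_trancl)

lemma marked_class_eq_iff:
  assumes "x \<in> carrier P" "S \<subseteq> vertices_of P x" "y \<in> carrier P" "T \<subseteq> vertices_of P y"
  shows "marked_class P x S = marked_class P y T \<longleftrightarrow> ((x, S), (y, T)) \<in> (marked_adj P)\<^sup>+"
  unfolding marked_class_def
  using assms by (intro eq_equiv_class_iff[OF equiv_marked]) (auto simp: marked_objects_def)

lemma marked_class_eqD:
  assumes "x \<in> carrier P" "S \<subseteq> vertices_of P x" "y \<in> carrier P" "T \<subseteq> vertices_of P y"
    and "marked_class P x S = marked_class P y T"
  shows "S = T"
  using assms marked_class_eq_iff marked_adj_trancl_snd[of "(x, S)" "(y, T)" P] by simp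

text \<open>
  The basic way to move inside a class: the underlying object may be replaced by any larger one.
  A common upper bound \<open>u\<close> of \<open>x\<close> and \<open>y\<close> thus lets two classes be rewritten over the same object.
\<close>

lemma marked_class_below:
  assumes "x \<in> carrier P" "y \<in> carrier P" "x \<sqsubseteq> y" "S \<subseteq> vertices_of P x"
  shows "marked_class P x S = marked_class P y S"
proof -
  have S: "S \<subseteq> vertices_of P y" using assms vertices_of_mono by blast
  have "((x, S), (y, S)) \<in> marked_adj P"
    using assms S by (auto simp: marked_adj_iff)
  then show ?thesis using assms S by (simp add: marked_class_eq_iff r_into_trancl)
qed

lemma carrier_transform:
  "carrier (simplicial_transform P) =
     {marked_class P x S |x S. x \<in> carrier P \<and> S \<subseteq> vertices_of P x}"
  by (auto simp: simplicial_transform_def marked_class_def marked_objects_def quotient_def)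

lemma marked_class_in_transform:
  assumes "x \<in> carrier P" "S \<subseteq> vertices_of P x"
  shows "marked_class P x S \<in> carrier (simplicial_transform P)"
  using assms by (auto simp: carrier_transform)

lemma mem_marked_classD:
  assumes "(x, S) \<in> c" "c \<in> carrier (simplicial_transform P)"
  shows "x \<in> carrier P \<and> S \<subseteq> vertices_of P x \<and> c = marked_class P x S"
proof -
  have c: "c \<in> marked_objects P // (marked_adj P)\<^sup>+"
    using assms by (simp add: simplicial_transform_def)
  have m: "(x, S) \<in> marked_objects P"
    using in_quotient_imp_subset[OF equiv_marked c] assms by blast
  have "c = marked_class P x S"
    unfolding marked_class_def
    using quotient_eq_iff[OF equiv_marked c quotientI[OF m] assms(1)]
      equiv_class_self[OF equiv_marked m] equiv_marked m
    by (auto simp: equiv_def refl_on_def)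
  then show ?thesis using m by (auto simp: marked_objects_def)
qed

lemma self_mem_marked_class:
  assumes "x \<in> carrier P" "S \<subseteq> vertices_of P x"
  shows "(x, S) \<in> marked_class P x S"
  unfolding marked_class_def
  using assms by (intro equiv_class_self[OF equiv_marked]) (auto simp: marked_objects_def)

text \<open>
  In this form the order of the transform is visibly antisymmetric: if also \<open>d\<close> is below \<open>c\<close>, the
  markings agree because each class determines its marking, and then \<open>c = d\<close>.
\<close>

lemma transform_le_iff:
  assumes c: "c \<in> carrier (simplicial_transform P)" and d: "d \<in> carrier (simplicial_transform P)"
  shows "c \<sqsubseteq>\<^bsub>simplicial_transform P\<^esub> d \<longleftrightarrow>
    (\<exists>u\<in>carrier P. \<exists>S T. S \<subseteq> T \<and> T \<subseteq> vertices_of P u \<and>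
       c = marked_class P u S \<and> d = marked_class P u T)"
    (is "?L \<longleftrightarrow> ?R")
proof
  assume ?L
  then have "\<exists>(x, S)\<in>c. \<exists>(y, T)\<in>d. S \<subseteq> T \<and> min_upper_bounds P x y \<noteq> {}"
    by (simp add: simplicial_transform_def)
  then obtain x S y T where xS: "(x, S) \<in> c" and yT: "(y, T) \<in> d" and ST: "S \<subseteq> T"
    and mub: "min_upper_bounds P x y \<noteq> {}"
    by blast
  note x = mem_marked_classD[OF xS c] and y = mem_marked_classD[OF yT d]
  obtain u where u: "u \<in> carrier P" "x \<sqsubseteq> u" "y \<sqsubseteq> u"
    using mub x y min_upper_bounds_nonempty_iff[of x y] by blast
  have "c = marked_class P u S" "d = marked_class P u T"
    using x y u marked_class_below[of x u S] marked_class_below[of y u T] by simp_all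
  moreover have "T \<subseteq> vertices_of P u"
    using y u vertices_of_mono by blast
  ultimately show ?R using u ST by blast
next
  assume ?R
  then obtain u S T where u: "u \<in> carrier P" "S \<subseteq> T" "T \<subseteq> vertices_of P u"
    "c = marked_class P u S" "d = marked_class P u T" by blast
  then have "(u, S) \<in> c" "(u, T) \<in> d" using self_mem_marked_class by blast+
  moreover have "min_upper_bounds P u u \<noteq> {}"
    using u min_upper_bounds_nonempty_iff by auto
  ultimately have "\<exists>(y, T')\<in>d. S \<subseteq> T' \<and> min_upper_bounds P u y \<noteq> {}"
    using u(2) by (intro bexI[of _ "(u, T)"]) simp_all
  then have "\<exists>(x, S')\<in>c. \<exists>(y, T')\<in>d. S' \<subseteq> T' \<and> min_upper_bounds P x y \<noteq> {}"
    using \<open>(u, S) \<in> c\<close> by (intro bexI[of _ "(u, S)"]) simp_all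
  then show ?L by (simp add: simplicial_transform_def)
qed

lemma marked_class_mono:
  assumes x: "x \<in> carrier P" "S \<subseteq> T" "T \<subseteq> vertices_of P x"
  shows "marked_class P x S \<sqsubseteq>\<^bsub>simplicial_transform P\<^esub> marked_class P x T"
proof -
  have "marked_class P x S \<in> carrier (simplicial_transform P)"
    "marked_class P x T \<in> carrier (simplicial_transform P)"
    using x by (auto intro: marked_class_in_transform)
  then show ?thesis using x by (subst transform_le_iff) blast+
qed

lemma marked_class_empty:
  assumes "x \<in> carrier P"
  shows "marked_class P x {} = marked_class P \<bottom> {}"
  using marked_class_below[of \<bottom> x "{}"] assms by simp

lemma marked_class_vertex:
  assumes x: "x \<in> carrier P" and v: "v \<in> vertices_of P x"
  shows "marked_class P v {v} = marked_class P x {v}"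
proof -
  have "v \<in> vertices P" "v \<sqsubseteq> x" using v by (simp_all add: vertices_of_def)
  then show ?thesis
    using x by (intro marked_class_below) (simp_all add: vertices_in_carrier vertices_of_vertex)
qed

text \<open>
  The bottom element is a choice among the least elements, so it is identified here by uniqueness: a
  class below that of \<open>(\<bottom>, {})\<close> has empty marking, and all empty markings are equivalent.
\<close>

lemma bottom_transform: "\<bottom>\<^bsub>simplicial_transform P\<^esub> = marked_class P \<bottom> {}"
proof -
  let ?s = "simplicial_transform P" and ?b = "marked_class P \<bottom> {}"
  have b: "?b \<in> carrier ?s" by (simp add: marked_class_in_transform)
  have "?b \<sqsubseteq>\<^bsub>?s\<^esub> c" if c: "c \<in> carrier ?s" for c
  proof -
    obtain x S where x: "x \<in> carrier P" "S \<subseteq> vertices_of P x" "c = marked_class P x S"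
      using c by (auto simp: carrier_transform)
    then show ?thesis
      using marked_class_mono[of x "{}" S] marked_class_empty[of x] by simp
  qed
  then have "least ?s ?b (carrier ?s)" using b by (auto simp: least_def)
  then have l: "least ?s \<bottom>\<^bsub>?s\<^esub> (carrier ?s)"
    unfolding bottom_def[of ?s] by (rule someI)
  then have b': "\<bottom>\<^bsub>?s\<^esub> \<in> carrier ?s" and "\<bottom>\<^bsub>?s\<^esub> \<sqsubseteq>\<^bsub>?s\<^esub> ?b"
    using b by (auto simp: least_def)
  then obtain u S T where u: "u \<in> carrier P" "S \<subseteq> T" "T \<subseteq> vertices_of P u"
    "\<bottom>\<^bsub>?s\<^esub> = marked_class P u S" "?b = marked_class P u T"
    using transform_le_iff[OF b' b] by blast
  then have "T = {}" using marked_class_eqD[of \<bottom> "{}" u T] by simp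
  then show ?thesis using marked_class_empty[OF u(1)] u by simp
qed

lemma transform_lless_iff:
  "c \<sqsubset>\<^bsub>simplicial_transform P\<^esub> d \<longleftrightarrow> c \<sqsubseteq>\<^bsub>simplicial_transform P\<^esub> d \<and> c \<noteq> d"
  by (simp add: lless_def simplicial_transform_def)

text \<open>
  Removing all but one element from a nonempty marking \<open>S\<close> gives a class below \<open>[x, S]\<close> other than the
  bottom, so a vertex has a singleton marking \<open>{v}\<close>, and the object can be moved down to \<open>v\<close> itself.
\<close>

lemma vertices_transform:
  "vertices (simplicial_transform P) = (\<lambda>v. marked_class P v {v}) ` vertices P"
proof (intro subset_antisym subsetI)
  let ?s = "simplicial_transform P"
  fix c assume c: "c \<in> vertices ?s"
  then have cs: "c \<in> carrier ?s" by (simp add: vertices_def)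
  then obtain x S where x: "x \<in> carrier P" "S \<subseteq> vertices_of P x" "c = marked_class P x S"
    by (auto simp: carrier_transform)
  have "S \<noteq> {}"
    using c marked_class_empty[OF x(1)] x(3) by (auto simp: vertices_def bottom_transform)
  then obtain v where v: "v \<in> S" by blast
  then have vP: "v \<in> vertices P" using x by (auto simp: vertices_of_def)
  define d where "d = marked_class P x {v}"
  have d: "d \<in> carrier ?s" "d \<sqsubseteq>\<^bsub>?s\<^esub> c"
    using x v by (auto simp: d_def intro: marked_class_in_transform marked_class_mono)
  have "d \<noteq> \<bottom>\<^bsub>?s\<^esub>"
    using marked_class_eqD[of x "{v}" \<bottom> "{}"] x v by (auto simp: d_def bottom_transform)
  then have "d = c" using c d by (auto simp: vertices_def transform_lless_iff)
  moreover have "marked_class P v {v} = d"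
    unfolding d_def using x v by (intro marked_class_vertex) auto
  ultimately show "c \<in> (\<lambda>v. marked_class P v {v}) ` vertices P" using vP by blast
next
  let ?s = "simplicial_transform P"
  fix c assume "c \<in> (\<lambda>v. marked_class P v {v}) ` vertices P"
  then obtain v where v: "v \<in> vertices P" "c = marked_class P v {v}" by blast
  have vc: "v \<in> carrier P" "{v} \<subseteq> vertices_of P v"
    using v(1) by (simp_all add: vertices_in_carrier vertices_of_vertex)
  have c: "c \<in> carrier ?s" unfolding v(2) using vc by (rule marked_class_in_transform)
  have "c \<noteq> \<bottom>\<^bsub>?s\<^esub>"
    using marked_class_eqD[of v "{v}" \<bottom> "{}"] v vc by (auto simp: bottom_transform)
  moreover have "d = \<bottom>\<^bsub>?s\<^esub>" if d: "d \<in> carrier ?s" "d \<sqsubset>\<^bsub>?s\<^esub> c" for d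
  proof -
    obtain u S T where u: "u \<in> carrier P" "S \<subseteq> T" "T \<subseteq> vertices_of P u"
      "d = marked_class P u S" "c = marked_class P u T"
      using d c by (auto simp: transform_lless_iff transform_le_iff)
    have "T = {v}" using marked_class_eqD[of u T v "{v}"] u v vc by simp
    moreover have "S \<noteq> T" using u d by (auto simp: transform_lless_iff)
    ultimately have "S = {}" using u by auto
    then show ?thesis
      using marked_class_empty[of u] u by (simp add: bottom_transform)
  qed
  ultimately show "c \<in> vertices ?s" using c by (auto simp: vertices_def)
qed

lemma vertices_of_transform:
  assumes x: "x \<in> carrier P" "S \<subseteq> vertices_of P x"
  shows "vertices_of (simplicial_transform P) (marked_class P x S) = (\<lambda>v. marked_class P v {v}) ` S"
proof (intro subset_antisym subsetI)
  let ?s = "simplicial_transform P" and ?c = "marked_class P x S"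
  have c: "?c \<in> carrier ?s" using x by (rule marked_class_in_transform)
  fix d assume d: "d \<in> vertices_of ?s ?c"
  then obtain v where v: "v \<in> vertices P" "d = marked_class P v {v}"
    by (auto simp: vertices_of_def vertices_transform)
  have ds: "d \<in> carrier ?s" using d by (auto simp: vertices_of_def vertices_def)
  obtain u A B where u: "u \<in> carrier P" "A \<subseteq> B" "B \<subseteq> vertices_of P u"
    "d = marked_class P u A" "?c = marked_class P u B"
    using d transform_le_iff[OF ds c] by (auto simp: vertices_of_def)
  have "{v} = A"
    using marked_class_eqD[of v "{v}" u A] v(2) u vertices_in_carrier[OF v(1)] vertices_of_vertex[OF v(1)] by simp
  moreover have "S = B" using marked_class_eqD[of x S u B] x u by simp
  ultimately show "d \<in> (\<lambda>v. marked_class P v {v}) ` S" using u v by blast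
next
  let ?s = "simplicial_transform P" and ?c = "marked_class P x S"
  fix d assume "d \<in> (\<lambda>v. marked_class P v {v}) ` S"
  then obtain v where v: "v \<in> S" "d = marked_class P v {v}" by blast
  then have "v \<in> vertices P" using x by (auto simp: vertices_of_def)
  then have dv: "d \<in> vertices ?s" using v by (auto simp: vertices_transform)
  have "d = marked_class P x {v}"
    unfolding v(2) using x v by (intro marked_class_vertex) auto
  then have "d \<sqsubseteq>\<^bsub>?s\<^esub> ?c" using x v by (auto intro: marked_class_mono)
  then show "d \<in> vertices_of ?s ?c" using dv by (simp add: vertices_of_def)
qed

lemma card_vertices_of_transform:
  assumes x: "x \<in> carrier P" "S \<subseteq> vertices_of P x"
  shows "card (vertices_of (simplicial_transform P) (marked_class P x S)) = card S"
proof -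
  have "inj_on (\<lambda>v. marked_class P v {v}) S"
  proof (rule inj_onI)
    fix v w assume "v \<in> S" "w \<in> S" and eq: "marked_class P v {v} = marked_class P w {w}"
    then have "v \<in> vertices P" "w \<in> vertices P" using x by (auto simp: vertices_of_def)
    then show "v = w"
      using marked_class_eqD[OF _ _ _ _ eq] by (simp add: vertices_in_carrier vertices_of_vertex)
  qed
  then show ?thesis by (simp add: vertices_of_transform[OF x] card_image)
qed

section \<open>The smallest representative of a class\<close>

definition spanning :: "'a \<Rightarrow> 'a set \<Rightarrow> 'a set" where
  "spanning x S = {y \<in> carrier P. y \<sqsubseteq> x \<and> S \<subseteq> vertices_of P y}"

text \<open>
  A minimal spanning object \<open>m\<close> is least: its meet with any other spanning object \<open>y\<close>, taken below
  \<open>x\<close>, still lies above every vertex in \<open>S\<close>, hence is spanning and equals \<open>m\<close>.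
\<close>

lemma ex_least_spanning:
  assumes poly: "polyhedral P" and x: "x \<in> carrier P" "S \<subseteq> vertices_of P x"
  shows "\<exists>m. least P m (spanning x S)"
proof -
  have "x \<in> spanning x S" using x by (simp add: spanning_def)
  then obtain m where m: "m \<in> spanning x S" "\<And>w. w \<in> spanning x S \<Longrightarrow> w \<sqsubseteq> m \<Longrightarrow> w = m"
    using ex_minimal[of "spanning x S"] by (auto simp: spanning_def)
  have "m \<sqsubseteq> y" if y: "y \<in> spanning x S" for y
  proof -
    interpret D: lower_semilattice "down_poset P x"
      using poly x by (simp add: polyhedral_def)
    have "m \<in> carrier (down_poset P x)" "y \<in> carrier (down_poset P x)"
      using m y by (auto simp: down_poset_def spanning_def)
    then obtain s where s: "greatest (down_poset P x) s (Lower (down_poset P x) {m, y})"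
      using D.inf_of_two_exists by blast
    then have sc: "s \<in> carrier P" "s \<sqsubseteq> x" "s \<sqsubseteq> m" "s \<sqsubseteq> y"
      and gr: "\<And>z. z \<in> carrier P \<Longrightarrow> z \<sqsubseteq> x \<Longrightarrow> z \<sqsubseteq> m \<Longrightarrow> z \<sqsubseteq> y \<Longrightarrow> z \<sqsubseteq> s"
      using m y by (auto simp: greatest_def Lower_def down_poset_def spanning_def)
    have "v \<in> vertices_of P s" if "v \<in> S" for v
    proof -
      have "v \<in> vertices P" "v \<sqsubseteq> m" "v \<sqsubseteq> y" "v \<sqsubseteq> x"
        using that m y x by (auto simp: spanning_def vertices_of_def)
      then show ?thesis using gr[of v] by (simp add: vertices_of_def vertices_in_carrier)
    qed
    then have "s \<in> spanning x S" using sc by (auto simp: spanning_def)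
    then show ?thesis using m(2) sc by blast
  qed
  then show ?thesis using m by (auto simp: least_def spanning_def)
qed

text \<open>
  Both \<open>x\<close> and \<open>y\<close> are spanning below their common upper bound \<open>u\<close>, so the least spanning object
  below \<open>u\<close> is already below \<open>x\<close> and below \<open>y\<close>, and is the least one there too.
\<close>

lemma least_spanning_adj:
  assumes poly: "polyhedral P" and adj: "((x, S), (y, T)) \<in> marked_adj P"
    and m: "least P m (spanning x S)"
  shows "least P m (spanning y T)"
proof -
  obtain u where u: "u \<in> carrier P" "x \<sqsubseteq> u" "y \<sqsubseteq> u" and eq: "S = T"
    and x: "x \<in> carrier P" "S \<subseteq> vertices_of P x"
    and y: "y \<in> carrier P" "S \<subseteq> vertices_of P y"
    using adj by (auto simp: marked_adj_iff)
  have "S \<subseteq> vertices_of P u" using x u vertices_of_mono by blast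
  then obtain n where n: "least P n (spanning u S)"
    using ex_least_spanning[OF poly u(1)] by blast
  have xs: "x \<in> spanning u S" and ys: "y \<in> spanning u S"
    using x y u by (auto simp: spanning_def)
  have mn: "m \<in> carrier P" "n \<in> carrier P" "m \<sqsubseteq> x" "S \<subseteq> vertices_of P m" "S \<subseteq> vertices_of P n"
    using m n by (auto simp: least_def spanning_def)
  have "n \<sqsubseteq> x" using n xs by (auto simp: least_def)
  then have "m \<sqsubseteq> n" using m mn by (auto simp: least_def spanning_def)
  moreover have "m \<sqsubseteq> u" using mn u x le_trans by blast
  then have "n \<sqsubseteq> m" using n mn by (auto simp: least_def spanning_def)
  ultimately have "m = n" using mn le_antisym by blast
  then have my: "m \<in> spanning y S"
    using n ys by (auto simp: least_def spanning_def)
  moreover have "m \<sqsubseteq> z" if "z \<in> spanning y S" for z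
  proof -
    have "z \<in> spanning u S" using that u y le_trans unfolding spanning_def by blast
    then show ?thesis using n \<open>m = n\<close> by (auto simp: least_def)
  qed
  ultimately show ?thesis using eq by (auto simp: least_def spanning_def)
qed

lemma least_spanning_trancl:
  assumes poly: "polyhedral P" and "(p, q) \<in> (marked_adj P)\<^sup>+"
    and "least P m (spanning (fst p) (snd p))"
  shows "least P m (spanning (fst q) (snd q))"
  using assms(2,3)
proof (induction rule: trancl_induct)
  case (base q)
  then show ?case using least_spanning_adj[OF poly, of "fst p" "snd p" "fst q" "snd q"] by simp
next
  case (step q r)
  then show ?case using least_spanning_adj[OF poly, of "fst q" "snd q" "fst r" "snd r"] by simp
qed

text \<open>
  With the next lemma: a marking \<open>S\<close> is uncovered at \<open>x\<close> exactly if \<open>(x, S)\<close> is the canonical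
  representative of its class.
\<close>

lemma least_spanning_uncovered:
  assumes poly: "polyhedral P" and x: "x \<in> carrier P" and S: "S \<in> uncovered i x"
  shows "least P x (spanning x S)"
proof -
  have Sx: "S \<subseteq> vertices_of P x" using S by (simp add: uncovered_def)
  obtain m where m: "least P m (spanning x S)" using ex_least_spanning[OF poly x Sx] by blast
  then have "m \<in> carrier P" "m \<sqsubseteq> x" "S \<subseteq> vertices_of P m" by (auto simp: least_def spanning_def)
  then have "m = x" using S by (auto simp: uncovered_def lless_iff)
  then show ?thesis using m by simp
qed

lemma uncovered_least_spanning:
  assumes x: "x \<in> carrier P" and m: "least P m (spanning x S)" and S: "card S = i + 1"
  shows "S \<in> uncovered i m"
proof -
  have mc: "m \<in> carrier P" "m \<sqsubseteq> x" "S \<subseteq> vertices_of P m"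
    using m by (auto simp: least_def spanning_def)
  have False if y: "y \<in> carrier P" "y \<sqsubset> m" "S \<subseteq> vertices_of P y" for y
  proof -
    have ym: "y \<sqsubseteq> m" "y \<noteq> m" using y by (auto simp: lless_iff)
    then have "y \<in> spanning x S" using y mc x le_trans unfolding spanning_def by blast
    then have "m \<sqsubseteq> y" using m by (auto simp: least_def)
    then show False using ym y mc le_antisym by blast
  qed
  then show ?thesis using mc S by (auto simp: uncovered_def)
qed

text \<open>
  Sending \<open>(x, S)\<close> with \<open>S\<close> uncovered to its class is a bijection.  It is injective because \<open>x\<close> is
  recovered from the class as the least spanning object, and surjective because every class contains
  the pair built on its least spanning object.
\<close>

lemma face_number_transform:
  assumes poly: "polyhedral P"
  shows "face_number (simplicial_transform P) i = (\<Sum>x\<in>carrier P. card (uncovered i x))"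
proof -
  let ?U = "SIGMA x:carrier P. uncovered i x"
  let ?f = "\<lambda>(x, S). marked_class P x S"
  have finU: "finite (uncovered i x)" for x
    using finite_vertices_of[of x] by (auto simp: uncovered_def intro: finite_subset[of _ "Pow (vertices_of P x)"])
  have "inj_on ?f ?U"
  proof (rule inj_onI, clarsimp)
    fix x S y T
    assume x: "x \<in> carrier P" and S: "S \<in> uncovered i x"
      and y: "y \<in> carrier P" and T: "T \<in> uncovered i y"
      and eq: "marked_class P x S = marked_class P y T"
    have ST: "S \<subseteq> vertices_of P x" "T \<subseteq> vertices_of P y" using S T by (auto simp: uncovered_def)
    have rel: "((x, S), (y, T)) \<in> (marked_adj P)\<^sup>+"
      using eq marked_class_eq_iff x y ST by blast
    have "least P x (spanning y T)"
      using least_spanning_trancl[OF poly rel, of x] least_spanning_uncovered[OF poly x S] by simp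
    moreover have "least P y (spanning y T)" by (rule least_spanning_uncovered[OF poly y T])
    ultimately have "x \<sqsubseteq> y" "y \<sqsubseteq> x" by (auto simp: least_def)
    then have "x = y" using x y le_antisym by blast
    then show "x = y \<and> S = T" using marked_class_eqD[OF x ST(1) y ST(2) eq] by simp
  qed
  moreover have "{c \<in> carrier (simplicial_transform P).
      card (vertices_of (simplicial_transform P) c) = i + 1} = ?f ` ?U"
  proof (intro subset_antisym subsetI)
    fix c assume "c \<in> {c \<in> carrier (simplicial_transform P).
      card (vertices_of (simplicial_transform P) c) = i + 1}"
    then obtain x S where x: "x \<in> carrier P" "S \<subseteq> vertices_of P x" "c = marked_class P x S"
      and S: "card S = i + 1"
      by (auto simp: carrier_transform card_vertices_of_transform)
    obtain m where m: "least P m (spanning x S)" using ex_least_spanning[OF poly x(1,2)] by blast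
    then have mc: "m \<in> carrier P" "m \<sqsubseteq> x" "S \<subseteq> vertices_of P m"
      by (auto simp: least_def spanning_def)
    have "c = marked_class P m S" using marked_class_below[of m x S] mc x by simp
    moreover have "S \<in> uncovered i m" by (rule uncovered_least_spanning[OF x(1) m S])
    ultimately show "c \<in> ?f ` ?U" using mc by force
  next
    fix c assume "c \<in> ?f ` ?U"
    then obtain x S where x: "x \<in> carrier P" "S \<in> uncovered i x" "c = marked_class P x S" by auto
    then have "S \<subseteq> vertices_of P x" "card S = i + 1" by (auto simp: uncovered_def)
    then show "c \<in> {c \<in> carrier (simplicial_transform P).
      card (vertices_of (simplicial_transform P) c) = i + 1}"
      using x by (auto simp: card_vertices_of_transform intro: marked_class_in_transform)
  qed
  ultimately show ?thesis
    using fin finU by (simp add: face_number_def card_image card_SigmaI)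
qed

section \<open>Counting by the number of vertices\<close>

text \<open>
  This is where regularity enters beyond the well-definedness of \<open>\<nu>\<close>: equal vertex sets would make
  the nested finite down-sets isomorphic, hence equal.
\<close>

lemma vertices_of_psubset:
  assumes reg: "regular_poset P" and y: "y \<in> carrier P" and x: "x \<in> carrier P" and less: "y \<sqsubset> x"
  shows "vertices_of P y \<subset> vertices_of P x"
proof (rule psubsetI)
  have yx: "y \<sqsubseteq> x" "y \<noteq> x" using less by (auto simp: lless_iff)
  then show "vertices_of P y \<subseteq> vertices_of P x" using x y vertices_of_mono by blast
  show "vertices_of P y \<noteq> vertices_of P x"
  proof
    assume "vertices_of P y = vertices_of P x"
    then have "poset_isomorphic (down_poset P y) (down_poset P x)"
      using reg x y unfolding regular_poset_def by simp
    then have "card (carrier (down_poset P y)) = card (carrier (down_poset P x))"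
      unfolding poset_isomorphic_def using bij_betw_same_card by blast
    moreover have "carrier (down_poset P y) \<subseteq> carrier (down_poset P x)"
      using yx x y by (auto simp: down_poset_def intro: le_trans)
    moreover have "finite (carrier (down_poset P x))" using fin by (simp add: down_poset_def)
    ultimately have "carrier (down_poset P y) = carrier (down_poset P x)"
      by (simp add: card_subset_eq)
    then have "x \<sqsubseteq> y" using x by (auto simp: down_poset_def)
    then show False using yx x y le_antisym by blast
  qed
qed

lemma uncovered_few_vertices:
  assumes "card (vertices_of P x) < i + 1"
  shows "uncovered i x = {}"
proof -
  have "S \<notin> uncovered i x" for S
    using assms card_mono[OF finite_vertices_of, of S x] by (auto simp: uncovered_def)
  then show ?thesis by blast
qed

lemma uncovered_all_vertices:
  assumes reg: "regular_poset P" and x: "x \<in> carrier P" "card (vertices_of P x) = i + 1"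
  shows "uncovered i x = {vertices_of P x}"
proof (intro subset_antisym subsetI)
  fix S assume "S \<in> uncovered i x"
  then show "S \<in> {vertices_of P x}"
    using x card_subset_eq[OF finite_vertices_of, of S x] by (auto simp: uncovered_def)
next
  fix S assume "S \<in> {vertices_of P x}"
  then show "S \<in> uncovered i x"
    using x vertices_of_psubset[OF reg _ x(1)] by (auto simp: uncovered_def)
qed

lemma uncovered_0:
  assumes x: "x \<in> carrier P" "card (vertices_of P x) > 1"
  shows "uncovered 0 x = {}"
proof (rule ccontr)
  assume "uncovered 0 x \<noteq> {}"
  then obtain v where v: "{v} \<subseteq> vertices_of P x" "{v} \<in> uncovered 0 x"
    by (auto simp: uncovered_def card_1_singleton_iff)
  then have vP: "v \<in> vertices P" "v \<sqsubseteq> x" by (auto simp: vertices_of_def)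
  have "v \<noteq> x" using x vertices_of_vertex[OF vP(1)] by auto
  then have "v \<sqsubset> x" using vP by (simp add: lless_iff)
  then show False
    using v vP vertices_in_carrier[OF vP(1)] vertices_of_vertex[OF vP(1)] by (auto simp: uncovered_def)
qed

text \<open>
  The case \<open>i = 0\<close> is separate because \<open>\<nu>\<^sub>0\<^sub>,\<^sub>k\<close> is zero by convention; the convention agrees with the
  count of uncovered markings.
\<close>

lemma face_number_times_nu:
  assumes reg: "regular_poset P" and k: "k > i"
  shows "face_number P k * nu P i k =
    (\<Sum>x | x \<in> carrier P \<and> card (vertices_of P x) = k + 1. card (uncovered i x))"
proof -
  have "card (uncovered i x) = nu P i k"
    if x: "x \<in> carrier P" "card (vertices_of P x) = k + 1" for x
  proof (cases "i = 0")
    case True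
    then show ?thesis using uncovered_0 x k by (simp add: nu_def)
  next
    case False
    then show ?thesis using nu_eq[OF fin reg x] nu_at_eq_card_uncovered[OF x(1)] by simp
  qed
  then show ?thesis by (simp add: face_number_def)
qed

lemma card_vertices_of_le_dim:
  assumes "x \<in> carrier P"
  shows "int (card (vertices_of P x)) \<le> poset_dim P + 1"
  using assms fin by (simp add: poset_dim_def)

lemma face_number_transform_eq:
  assumes poly: "polyhedral P" and reg: "regular_poset P"
  shows "face_number (simplicial_transform P) i =
    face_number P i + (\<Sum>k | i + 1 \<le> k \<and> int k \<le> poset_dim P. face_number P k * nu P i k)"
proof -
  let ?n = "\<lambda>x. card (vertices_of P x)" and ?u = "\<lambda>x. card (uncovered i x)"
  let ?K = "{k. i + 1 \<le> k \<and> int k \<le> poset_dim P}"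
  \<comment> \<open>Objects with at most \<open>i\<close> vertices have no uncovered marking of size \<open>i + 1\<close>; \<open>L\<close> gives the
    leading term and \<open>H\<close> the sum over \<open>k\<close>.\<close>
  define L where "L = {x \<in> carrier P. ?n x = i + 1}"
  define H where "H = {x \<in> carrier P. ?n x > i + 1}"
  have finLH: "finite L" "finite H" using fin by (simp_all add: L_def H_def)
  have finK: "finite ?K" by (rule finite_subset[of _ "{..nat (poset_dim P)}"]) auto
  have "?u x = 0" if "x \<in> carrier P - (L \<union> H)" for x
    using that uncovered_few_vertices[of x i] by (auto simp: L_def H_def)
  then have "sum ?u (carrier P) = sum ?u (L \<union> H)"
    using fin by (intro sum.mono_neutral_right) (auto simp: L_def H_def)
  also have "\<dots> = sum ?u L + sum ?u H"
    using finLH by (intro sum.union_disjoint) (auto simp: L_def H_def)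
  also have "sum ?u L = face_number P i"
    using uncovered_all_vertices[OF reg] by (simp add: L_def face_number_def)
  also have "sum ?u H = (\<Sum>k\<in>?K. \<Sum>x | x \<in> H \<and> ?n x - 1 = k. ?u x)"
  proof -
    have "(\<lambda>x. ?n x - 1) ` H \<subseteq> ?K"
      using card_vertices_of_le_dim by (fastforce simp: H_def)
    then show ?thesis by (intro sum.group[symmetric] finLH finK)
  qed
  also have "\<dots> = (\<Sum>k\<in>?K. face_number P k * nu P i k)"
  proof (rule sum.cong)
    fix k assume k: "k \<in> ?K"
    then have "{x. x \<in> H \<and> ?n x - 1 = k} = {x. x \<in> carrier P \<and> ?n x = k + 1}"
      by (auto simp: H_def)
    then show "(\<Sum>x | x \<in> H \<and> ?n x - 1 = k. ?u x) = face_number P k * nu P i k"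
      using face_number_times_nu[OF reg, of i k] k by simp
  qed simp
  finally show ?thesis using face_number_transform[OF poly] by simp
qed

end

theorem proposition7p2:
  fixes P :: "'a gorder"
  assumes "pointed_poset P"
    and "finite (carrier P)"
    and "polyhedral P"
    and "regular_poset P"
  shows "\<forall>i. face_number (simplicial_transform P) i =
    face_number P i + (\<Sum>k | i + 1 \<le> k \<and> int k \<le> poset_dim P. face_number P k * nu P i k)"
proof -
  interpret finite_pointed_poset P
    using assms by (simp add: finite_pointed_poset_def finite_pointed_poset_axioms_def)
  show ?thesis using assms face_number_transform_eq by blast
qed

end
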